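(* If $G$ is an $n$-vertex graph with minimum degree $\delta$, then $$\alpha'_*(G)\ \ge\ \frac{n\delta}{q_1(G)},$$ with equality if and only if $k=\frac{n(q_1(G)-2\delta)}{q_1(G)}$ is an integer and $G$ is an element of $\mathcal{H}(\delta,k)$.
   Context: Graphs are simple and undirected. For a graph $G$, $A(G)$ is its adjacency matrix, $D(G)$ the diagonal matrix of vertex degrees, $Q(G)=D(G)+A(G)$ its signless Laplacian, and $q_1(G)$ the largest eigenvalue of $Q(G)$ (signless Laplacian spectral radius). A fractional matching of $G$ is a function $f:E(G)\to[0,1]$ such that $\sum_{e\in\Gamma(v)}f(e)\le 1$ for each $v\in V(G)$, where $\Gamma(v)$ is the set of edges incident to $v$. The fractional matching number $\alpha'_*(G)$ is the maximum of $\sum_{e\in E(G)}f(e)$ over all fractional matchings $f$ of $G$. For positive integers $\delta$ and $k$, $\mathcal{H}(\delta,k)$ is the family of connected bipartite graphs $H$ with bipartition $V(H)=V_1\cup V_2$ such that (i) every vertex in $V_1$ has degree $\delta$, (ii) $|V_1|=|V_2|+k$, and (iii) the degrees of the vertices in $V_2$ are all equal.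
   Formalization: The equality characterization is stated only for connected G with k = n(q_1−2δ)/q_1 > 0; as written it fails for a triangle (equality with k = 0) and for two disjoint copies of P_3 (equality, but not connected). For edgeless G the bound is read as 0 ≥ 0. *)

theory Defs
  imports "HOL-Analysis.Analysis"
begin

(* A graph is given by its edge set; its vertex set is the whole finite type 'a,
   so the number of vertices n is CARD('a). *)
definition simple_graph :: "'a::finite set set \<Rightarrow> bool" where
  "simple_graph E \<longleftrightarrow> (\<forall>e\<in>E. card e = 2)"

definition incident_edges :: "'a::finite set set \<Rightarrow> 'a \<Rightarrow> 'a set set" where
  "incident_edges E v = {e \<in> E. v \<in> e}"

definition degree :: "'a::finite set set \<Rightarrow> 'a \<Rightarrow> nat" where
  "degree E v = card (incident_edges E v)"

definition min_degree :: "'a::finite set set \<Rightarrow> nat" where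
  "min_degree E = Min (range (degree E))"

definition connected_graph :: "'a::finite set set \<Rightarrow> bool" where
  "connected_graph E \<longleftrightarrow> (\<forall>u v. (u, v) \<in> {(x, y). {x, y} \<in> E}\<^sup>*)"

definition adjacency_matrix :: "'a::finite set set \<Rightarrow> real^'a^'a" where
  "adjacency_matrix E = (\<chi> i j. if {i, j} \<in> E then 1 else 0)"

definition degree_matrix :: "'a::finite set set \<Rightarrow> real^'a^'a" where
  "degree_matrix E = (\<chi> i j. if i = j then real (degree E i) else 0)"

definition signless_laplacian :: "'a::finite set set \<Rightarrow> real^'a^'a" where
  "signless_laplacian E = degree_matrix E + adjacency_matrix E"

definition eigenvalue :: "real^'n^'n \<Rightarrow> real \<Rightarrow> bool" where
  "eigenvalue M c \<longleftrightarrow> (\<exists>x. x \<noteq> 0 \<and> M *v x = c *s x)"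

(* The matrix is real symmetric, so its set of real eigenvalues is its whole spectrum;
   it is finite and nonempty. *)
definition q1 :: "'a::finite set set \<Rightarrow> real" where
  "q1 E = Max {c. eigenvalue (signless_laplacian E) c}"

definition fractional_matching :: "'a::finite set set \<Rightarrow> ('a set \<Rightarrow> real) \<Rightarrow> bool" where
  "fractional_matching E f \<longleftrightarrow>
     (\<forall>e\<in>E. 0 \<le> f e \<and> f e \<le> 1) \<and> (\<forall>v. (\<Sum>e\<in>incident_edges E v. f e) \<le> 1)"

(* GREATEST, since Max only makes sense on finite sets of values. The maximum is attained
   because the fractional matchings, restricted to E, form a compact set. *)
definition fractional_matching_number :: "'a::finite set set \<Rightarrow> real" where
  "fractional_matching_number E =
     (GREATEST s. \<exists>f. fractional_matching E f \<and> s = (\<Sum>e\<in>E. f e))"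

definition bipartition :: "'a::finite set set \<Rightarrow> 'a set \<Rightarrow> 'a set \<Rightarrow> bool" where
  "bipartition E V1 V2 \<longleftrightarrow>
     V1 \<union> V2 = UNIV \<and> V1 \<inter> V2 = {} \<and> (\<forall>e\<in>E. \<exists>u\<in>V1. \<exists>v\<in>V2. e = {u, v})"

(* The family is only defined for positive parameters; outside that range it is empty here. *)
definition family_H :: "nat \<Rightarrow> nat \<Rightarrow> 'a::finite set set set" where
  "family_H \<delta> k = {E. 0 < \<delta> \<and> 0 < k \<and> simple_graph E \<and> connected_graph E \<and>
     (\<exists>V1 V2. bipartition E V1 V2 \<and>
        (\<forall>v\<in>V1. degree E v = \<delta>) \<and>
        card V1 = card V2 + k \<and>
        (\<forall>u\<in>V2. \<forall>v\<in>V2. degree E u = degree E v))}"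

end

theory Submission
  imports Defs
begin

text \<open>
  Hall's theorem with deficiency, applied to the bipartite double cover of the graph, yields
  disjoint vertex sets \<open>S\<close>, \<open>T\<close> such that all neighbours of \<open>T\<close> lie in \<open>S\<close> and the fractional
  matching number is \<open>(n + |S| - |T|) / 2\<close>. Evaluating the Rayleigh quotient of the signless Laplacian
  at the vector that is \<open>|S|\<close> on \<open>T\<close> and \<open>|T|\<close> on \<open>S\<close> gives \<open>\<delta> (|S| + |T|) \<le> q |S|\<close>, and the
  all-ones vector gives \<open>2 \<delta> \<le> q\<close>; together they give the bound. In case of equality with \<open>q > 2 \<delta>\<close>
  the sets \<open>S\<close> and \<open>T\<close> exhaust the vertices and the test vector is an eigenvector, which makes the
  graph bipartite and biregular.
\<close>

section \<open>Systems of distinct representatives\<close>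

text \<open>Halmos-Vaughan induction on the size of the index set: a nonempty proper subfamily that
  meets Hall's condition with equality splits the problem in two; if there is none, one
  representative can be chosen freely.\<close>

lemma hall_marriage:
  fixes A :: "'i \<Rightarrow> 'b set"
  assumes "finite I" and "\<And>i. i \<in> I \<Longrightarrow> finite (A i)"
    and "\<And>J. J \<subseteq> I \<Longrightarrow> card J \<le> card (\<Union>(A ` J))"
  shows "\<exists>R. inj_on R I \<and> (\<forall>i\<in>I. R i \<in> A i)"
  using assms
proof (induction "card I" arbitrary: I A rule: less_induct)
  case less
  note fin = less.prems(1) and finA = less.prems(2) and hall = less.prems(3)
  consider "I = {}"
    | J where "J \<subset> I" "J \<noteq> {}" "card (\<Union>(A ` J)) = card J"
    | "I \<noteq> {}" "\<And>J. J \<subset> I \<Longrightarrow> J \<noteq> {} \<Longrightarrow> card J < card (\<Union>(A ` J))"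
    using hall by (metis le_neq_implies_less psubset_imp_subset)
  then show ?case
  proof cases
    case 1
    then show ?thesis by simp
  next
    case (2 J)
    let ?B = "\<Union>(A ` J)"
    have finJ: "finite J"
      using 2 fin by (meson finite_subset psubsetE)
    have "\<exists>R. inj_on R J \<and> (\<forall>i\<in>J. R i \<in> A i)"
    proof (rule less.hyps)
      show "card J < card I"
        using 2 fin by (simp add: psubset_card_mono)
      show "finite J" by (rule finJ)
    qed (use 2 finA hall in auto)
    then obtain R1 where R1: "inj_on R1 J" "\<And>i. i \<in> J \<Longrightarrow> R1 i \<in> A i"
      by blast
    have "\<exists>R. inj_on R (I - J) \<and> (\<forall>i\<in>I - J. R i \<in> A i - ?B)"
    proof (rule less.hyps)
      show "card (I - J) < card I"
        using 2 fin by (intro psubset_card_mono) auto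
      show "finite (I - J)" using fin by simp
      show "finite (A i - ?B)" if "i \<in> I - J" for i using that finA by simp
      fix K assume K: "K \<subseteq> I - J"
      \<comment> \<open>Hall's condition survives the deletion of \<open>?B\<close>: apply it to
        \<open>K \<union> J\<close> and cancel the equality that holds for \<open>J\<close>.\<close>
      have "card K + card J = card (K \<union> J)"
        using K finJ fin by (subst card_Un_disjoint) (auto intro: finite_subset)
      also have "\<dots> \<le> card (\<Union>(A ` (K \<union> J)))"
        using K 2 by (intro hall) auto
      also have "\<Union>(A ` (K \<union> J)) = (\<Union>i\<in>K. A i - ?B) \<union> ?B" by auto
      also have "card \<dots> \<le> card (\<Union>i\<in>K. A i - ?B) + card ?B"
        by (rule card_Un_le)
      finally show "card K \<le> card (\<Union>i\<in>K. A i - ?B)"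
        using 2 by simp
    qed
    then obtain R2 where R2: "inj_on R2 (I - J)" "\<And>i. i \<in> I - J \<Longrightarrow> R2 i \<in> A i - ?B"
      by blast
    let ?R = "\<lambda>i. if i \<in> J then R1 i else R2 i"
    have "inj_on ?R I"
    proof (rule inj_onI)
      fix x y assume xy: "x \<in> I" "y \<in> I" "?R x = ?R y"
      show "x = y"
        using xy R1 R2(2)[of x] R2(2)[of y] inj_onD[OF R1(1)] inj_onD[OF R2(1)]
        by (auto split: if_splits) metis+
    qed
    moreover have "\<forall>i\<in>I. ?R i \<in> A i"
      using R1 R2 by auto
    ultimately show ?thesis by blast
  next
    case 3
    then obtain i where i: "i \<in> I" by blast
    have "card {i} \<le> card (\<Union>(A ` {i}))"
      using i by (intro hall) auto
    then obtain a where a: "a \<in> A i"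
      by (metis all_not_in_conv card.empty card_1_singleton_iff image_empty image_insert
          Union_insert Union_empty sup_bot_right not_one_le_zero One_nat_def)
    \<comment> \<open>Deleting \<open>a\<close> shrinks every union by at most one, which the strict
      inequality for nonempty proper subfamilies absorbs.\<close>
    have "\<exists>R. inj_on R (I - {i}) \<and> (\<forall>j\<in>I - {i}. R j \<in> A j - {a})"
    proof (rule less.hyps)
      show "card (I - {i}) < card I"
        using fin i by (intro psubset_card_mono) auto
      show "finite (I - {i})" using fin by simp
      show "finite (A j - {a})" if "j \<in> I - {i}" for j using that finA by simp
      fix J assume J: "J \<subseteq> I - {i}"
      have eq: "(\<Union>j\<in>J. A j - {a}) = \<Union>(A ` J) - {a}" by auto
      show "card J \<le> card (\<Union>j\<in>J. A j - {a})"
      proof (cases "J = {}")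
        case False
        have "card J < card (\<Union>(A ` J))"
          using J i False by (intro 3(2)) auto
        moreover have "card (\<Union>(A ` J)) - 1 \<le> card (\<Union>(A ` J) - {a})"
          using diff_card_le_card_Diff[of "{a}" "\<Union>(A ` J)"] by simp
        ultimately show ?thesis unfolding eq by linarith
      qed simp
    qed
    then obtain R where R: "inj_on R (I - {i})" "\<And>j. j \<in> I - {i} \<Longrightarrow> R j \<in> A j - {a}"
      by blast
    have "inj_on (R(i := a)) I"
    proof (rule inj_onI)
      fix x y assume "x \<in> I" "y \<in> I" "(R(i := a)) x = (R(i := a)) y"
      then show "x = y"
        using R(2)[of x] R(2)[of y] inj_onD[OF R(1), of x y] by (auto split: if_splits)
    qed
    moreover have "\<forall>j\<in>I. (R(i := a)) j \<in> A j"
      using R a by auto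
    ultimately show ?thesis by blast
  qed
qed

text \<open>Ore's deficiency version, obtained from the marriage theorem by adding
  \<open>d\<close> dummy elements to every set.\<close>

lemma hall_deficiency:
  fixes A :: "'i \<Rightarrow> 'b set"
  assumes "finite I" and "\<And>i. i \<in> I \<Longrightarrow> finite (A i)"
    and def: "\<And>J. J \<subseteq> I \<Longrightarrow> card J \<le> card (\<Union>(A ` J)) + d"
  shows "\<exists>M R. M \<subseteq> I \<and> card I \<le> card M + d \<and> inj_on R M \<and> (\<forall>i\<in>M. R i \<in> A i)"
proof -
  let ?A = "\<lambda>i. Inl ` A i \<union> Inr ` {..<d}"
  have fin: "finite (\<Union>(A ` J))" if "J \<subseteq> I" for J
    using that assms by (meson finite_UN_I finite_subset subsetD)
  have "\<exists>R. inj_on R I \<and> (\<forall>i\<in>I. R i \<in> ?A i)"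
  proof (rule hall_marriage)
    fix J assume J: "J \<subseteq> I"
    show "card J \<le> card (\<Union>(?A ` J))"
    \<comment> \<open>The dummies enter the union only if \<open>J\<close> is nonempty.\<close>
    proof (cases "J = {}")
      case False
      then have "\<Union>(?A ` J) = \<Union>(A ` J) <+> {..<d}" by auto
      then show ?thesis using def[OF J] fin[OF J] by (simp add: card_Plus)
    qed simp
  qed (use assms in auto)
  then obtain R where R: "inj_on R I" "\<And>i. i \<in> I \<Longrightarrow> R i \<in> ?A i" by blast
  \<comment> \<open>The indices with a genuine representative; all others inject into the
    \<open>d\<close> dummies.\<close>
  define M where "M = {i \<in> I. R i \<in> range Inl}"
  have "card (I - M) \<le> card (Inr ` {..<d} :: ('b + nat) set)"
  proof (rule card_inj_on_le)
    show "inj_on R (I - M)" using R(1) by (rule inj_on_subset) auto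
    show "R ` (I - M) \<subseteq> Inr ` {..<d}" using R(2) by (fastforce simp: M_def)
  qed simp
  also have "\<dots> = d" by (simp add: card_image)
  finally have "card I \<le> card M + d"
    using \<open>finite I\<close> by (simp add: card_Diff_subset M_def)
  moreover have "inj_on (projl \<circ> R) M"
    using R(1) by (auto simp: M_def inj_on_def)
  moreover have "(projl \<circ> R) i \<in> A i" if "i \<in> M" for i
    using R(2)[of i] that by (auto simp: M_def)
  moreover have "M \<subseteq> I" by (auto simp: M_def)
  ultimately show ?thesis by blast
qed

section \<open>The largest eigenvalue of a symmetric matrix\<close>

text \<open>The form vanishes at \<open>x\<close> and has gradient twice \<open>A *v x\<close>
  there, so if \<open>A *v x\<close> were nonzero, a short step against it would make the form
  negative.\<close>

lemma psd_null_vector: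
  fixes A :: "real^'n^'n"
  assumes sym: "transpose A = A" and psd: "\<And>y. 0 \<le> y \<bullet> (A *v y)" and null: "x \<bullet> (A *v x) = 0"
  shows "A *v x = 0"
proof (rule ccontr)
  let ?w = "A *v x"
  assume "?w \<noteq> 0"
  then have w: "?w \<bullet> ?w > 0" by simp
  have comm: "x \<bullet> (A *v y) = y \<bullet> (A *v x)" for y
    by (metis dot_lmul_matrix inner_commute sym vector_transpose_matrix)
  define b where "b = ?w \<bullet> (A *v ?w)"
  have b: "b \<ge> 0" unfolding b_def by (rule psd)
  have ineq: "0 \<le> r * (r * b - 2 * (?w \<bullet> ?w))" for r
  proof -
    have "(x - r *\<^sub>R ?w) \<bullet> (A *v (x - r *\<^sub>R ?w)) = r * (r * b - 2 * (?w \<bullet> ?w))"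
      by (simp add: matrix_vector_mult_diff_distrib matrix_vector_mult_scaleR inner_diff_left
          inner_diff_right null comm[of ?w] b_def algebra_simps)
    then show ?thesis using psd by metis
  qed
  \<comment> \<open>The denominator \<open>b + 1\<close> also covers \<open>b = 0\<close>; this step
    is short enough for the linear term to dominate the quadratic one.\<close>
  define r where "r = (?w \<bullet> ?w) / (b + 1)"
  have r: "r > 0" using w b by (simp add: r_def)
  have "r * b \<le> ?w \<bullet> ?w"
    using w b by (simp add: r_def field_simps)
  then have "r * (r * b - 2 * (?w \<bullet> ?w)) < 0"
    using w r by (intro mult_pos_neg) linarith+
  then show False using ineq[of r] by linarith
qed

text \<open>Eigenvectors for distinct eigenvalues are orthogonal, and a pairwise orthogonal set in
  finite dimension is finite.\<close>

lemma finite_eigenvalues_symmetric: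
  fixes A :: "real^'n^'n"
  assumes sym: "transpose A = A"
  shows "finite {c. eigenvalue A c}"
proof -
  let ?C = "{c. eigenvalue A c}"
  have "\<forall>c\<in>?C. \<exists>x. x \<noteq> 0 \<and> A *v x = c *s x"
    by (simp add: eigenvalue_def)
  then obtain v where v: "\<And>c. c \<in> ?C \<Longrightarrow> v c \<noteq> 0 \<and> A *v v c = c *s v c"
    using bchoice[of ?C "\<lambda>c x. x \<noteq> 0 \<and> A *v x = c *s x"] by blast
  have comm: "x \<bullet> (A *v y) = (A *v x) \<bullet> y" for x y
    by (metis dot_lmul_matrix sym vector_transpose_matrix)
  have orth: "v c \<bullet> v c' = 0" if "c \<in> ?C" "c' \<in> ?C" "c \<noteq> c'" for c c'
    using comm[of "v c" "v c'"] v[OF that(1)] v[OF that(2)] that(3)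
    by (simp add: scalar_mult_eq_scaleR)
  have inj: "inj_on v ?C"
    using orth v by (metis inj_onI inner_eq_zero_iff)
  have "pairwise orthogonal (v ` ?C)"
    unfolding pairwise_def orthogonal_def using orth by blast
  then have "finite (v ` ?C)" by (rule pairwise_orthogonal_imp_finite)
  then show ?thesis using inj by (rule finite_imageD)
qed

text \<open>By compactness the form attains a maximum \<open>m\<close> on the unit sphere. Then
  \<open>mat m - A\<close> is positive semidefinite, so vectors attaining the bound are its null
  vectors, that is, eigenvectors for \<open>m\<close>; the bound rules out larger
  eigenvalues.\<close>

lemma max_eigenvalue_symmetric:
  fixes A :: "real^'n^'n"
  assumes sym: "transpose A = A"
  defines "q \<equiv> Max {c. eigenvalue A c}"
  shows rayleigh_le_max_eigenvalue: "x \<bullet> (A *v x) \<le> q * (x \<bullet> x)"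
    and rayleigh_eq_imp_eigenvector: "x \<bullet> (A *v x) = q * (x \<bullet> x) \<Longrightarrow> A *v x = q *s x"
    and max_eigenvalue_is_eigenvalue: "eigenvalue A q"
proof -
  have "\<exists>z\<in>sphere 0 1. \<forall>y\<in>sphere 0 1. y \<bullet> (A *v y) \<le> z \<bullet> (A *v z)"
  proof (rule continuous_attains_sup)
    show "sphere 0 1 \<noteq> ({} :: (real^'n) set)" by simp
    show "continuous_on (sphere 0 1) (\<lambda>y. y \<bullet> (A *v y))"
      by (intro continuous_intros linear_continuous_on matrix_vector_mul_bounded_linear)
  qed simp
  then obtain z where z: "norm z = 1" "\<And>y. norm y = 1 \<Longrightarrow> y \<bullet> (A *v y) \<le> z \<bullet> (A *v z)"
    by auto
  define m where "m = z \<bullet> (A *v z)"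
  have bound: "y \<bullet> (A *v y) \<le> m * (y \<bullet> y)" for y
  proof (cases "y = 0")
    case False
    then have "sgn y \<bullet> (A *v sgn y) \<le> m"
      unfolding m_def by (intro z(2)) (simp add: norm_sgn)
    then have "(y \<bullet> (A *v y)) / (norm y)\<^sup>2 \<le> m"
      by (simp add: sgn_div_norm matrix_vector_mult_scaleR power2_eq_square field_simps)
    then show ?thesis using False
      by (simp add: divide_le_eq dot_square_norm)
  qed simp
  let ?B = "mat m - A"
  have Bv: "?B *v y = m *s y - A *v y" for y
    by (simp add: vec_eq_iff matrix_vector_mult_def mat_def left_diff_distrib sum_subtractf
        if_distrib[of "\<lambda>a. a * _"] cong: if_cong)
  have eig: "A *v y = m *s y" if "y \<bullet> (A *v y) = m * (y \<bullet> y)" for y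
  proof -
    have "?B *v y = 0"
    proof (rule psd_null_vector)
      show "transpose ?B = ?B"
        using sym by (auto simp: transpose_def mat_def vec_eq_iff)
      show "0 \<le> x \<bullet> (?B *v x)" for x
        using bound[of x] by (simp add: Bv inner_diff_right scalar_mult_eq_scaleR)
      show "y \<bullet> (?B *v y) = 0"
        using that by (simp add: Bv inner_diff_right scalar_mult_eq_scaleR)
    qed
    then show ?thesis by (simp add: Bv)
  qed
  have zz: "z \<bullet> z = 1" using z(1) by (simp add: dot_square_norm)
  have "A *v z = m *s z" by (rule eig) (simp add: zz m_def)
  moreover have "z \<noteq> 0" using z(1) by auto
  ultimately have m: "eigenvalue A m" by (auto simp: eigenvalue_def)
  have "c \<le> m" if c: "eigenvalue A c" for c
  proof -
    obtain y where y: "y \<noteq> 0" "A *v y = c *s y" using c by (auto simp: eigenvalue_def)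
    then have "c * (y \<bullet> y) \<le> m * (y \<bullet> y)"
      using bound[of y] by (simp add: scalar_mult_eq_scaleR)
    then show ?thesis using y by simp
  qed
  then have qm: "q = m"
    unfolding q_def using m finite_eigenvalues_symmetric[OF sym] by (intro Max_eqI) auto
  show "x \<bullet> (A *v x) \<le> q * (x \<bullet> x)" using bound qm by simp
  show "A *v x = q *s x" if "x \<bullet> (A *v x) = q * (x \<bullet> x)" using eig that qm by simp
  show "eigenvalue A q" using m qm by simp
qed

section \<open>The signless Laplacian\<close>

lemma degree_eq_card_neighbours:
  assumes "simple_graph E"
  shows "degree E i = card {j. {i, j} \<in> E}"
proof -
  have "e \<in> (\<lambda>j. {i, j}) ` {j. {i, j} \<in> E}" if e: "e \<in> E" "i \<in> e" for e
  proof -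
    have "card e = 2" using assms e(1) by (simp add: simple_graph_def)
    then obtain x y where "e = {x, y}" by (auto simp: card_2_iff)
    with e show ?thesis by (auto simp: insert_commute)
  qed
  then have "incident_edges E i = (\<lambda>j. {i, j}) ` {j. {i, j} \<in> E}"
    by (auto simp: incident_edges_def)
  moreover have "inj_on (\<lambda>j. {i, j}) {j. {i, j} \<in> E}"
    by (auto simp: inj_on_def doubleton_eq_iff)
  ultimately show ?thesis by (simp add: degree_def card_image)
qed

lemma degree_eq_sum_adjacency:
  assumes "simple_graph E"
  shows "real (degree E i) = (\<Sum>j\<in>UNIV. adjacency_matrix E $ i $ j)"
  using degree_eq_card_neighbours[OF assms]
  by (simp add: adjacency_matrix_def flip: sum.inter_filter)

lemma adjacency_matrix_commute: "adjacency_matrix E $ i $ j = adjacency_matrix E $ j $ i"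
  by (simp add: adjacency_matrix_def insert_commute)

lemma signless_laplacian_mult:
  assumes "simple_graph E"
  shows "(signless_laplacian E *v x) $ i = (\<Sum>j\<in>UNIV. adjacency_matrix E $ i $ j * (x $ i + x $ j))"
proof -
  have "(signless_laplacian E *v x) $ i
      = (\<Sum>j\<in>UNIV. degree_matrix E $ i $ j * x $ j) + (\<Sum>j\<in>UNIV. adjacency_matrix E $ i $ j * x $ j)"
    by (simp add: signless_laplacian_def matrix_vector_mult_def distrib_right sum.distrib)
  also have "(\<Sum>j\<in>UNIV. degree_matrix E $ i $ j * x $ j) = real (degree E i) * x $ i"
    by (simp add: degree_matrix_def if_distrib[of "\<lambda>a. a * _"] cong: if_cong)
  finally show ?thesis
    by (simp add: degree_eq_sum_adjacency[OF assms] sum_distrib_right sum.distrib distrib_left)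
qed

text \<open>Swapping the summation indices turns the factor \<open>x $ i\<close> into
  \<open>x $ j\<close>; adding both versions completes the square. Ordered pairs count every edge
  twice, hence the factor 2.\<close>

lemma signless_laplacian_quadratic_form:
  assumes "simple_graph E"
  shows "2 * (x \<bullet> (signless_laplacian E *v x))
    = (\<Sum>i\<in>UNIV. \<Sum>j\<in>UNIV. adjacency_matrix E $ i $ j * (x $ i + x $ j)\<^sup>2)"
proof -
  let ?a = "\<lambda>i j. adjacency_matrix E $ i $ j"
  have 1: "x \<bullet> (signless_laplacian E *v x) = (\<Sum>i\<in>UNIV. \<Sum>j\<in>UNIV. ?a i j * (x $ i + x $ j) * x $ i)"
    by (simp add: inner_vec_def signless_laplacian_mult[OF assms] sum_distrib_left mult_ac)
  also have "\<dots> = (\<Sum>j\<in>UNIV. \<Sum>i\<in>UNIV. ?a i j * (x $ i + x $ j) * x $ i)"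
    by (rule sum.swap)
  also have "\<dots> = (\<Sum>i\<in>UNIV. \<Sum>j\<in>UNIV. ?a i j * (x $ i + x $ j) * x $ j)"
    by (intro sum.cong refl) (metis add.commute adjacency_matrix_commute)
  finally have 2: "x \<bullet> (signless_laplacian E *v x) = \<dots>" .
  have "2 * (x \<bullet> (signless_laplacian E *v x))
      = (\<Sum>i\<in>UNIV. \<Sum>j\<in>UNIV. ?a i j * (x $ i + x $ j) * x $ i)
      + (\<Sum>i\<in>UNIV. \<Sum>j\<in>UNIV. ?a i j * (x $ i + x $ j) * x $ j)"
    using 1 2 by linarith
  also have "\<dots> = (\<Sum>i\<in>UNIV. \<Sum>j\<in>UNIV. ?a i j * (x $ i + x $ j)\<^sup>2)"
    unfolding sum.distrib[symmetric]
    by (intro sum.cong refl) (simp add: power2_eq_square algebra_simps)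
  finally show ?thesis .
qed

lemma transpose_signless_laplacian: "transpose (signless_laplacian E) = signless_laplacian E"
  by (auto simp: transpose_def signless_laplacian_def degree_matrix_def adjacency_matrix_def
      vec_eq_iff insert_commute)

lemma q1_properties:
  shows rayleigh_le_q1: "x \<bullet> (signless_laplacian E *v x) \<le> q1 E * (x \<bullet> x)"
    and rayleigh_eq_q1_imp_eigenvector:
      "x \<bullet> (signless_laplacian E *v x) = q1 E * (x \<bullet> x) \<Longrightarrow> signless_laplacian E *v x = q1 E *s x"
    and q1_is_eigenvalue: "eigenvalue (signless_laplacian E) (q1 E)"
  unfolding q1_def
  using max_eigenvalue_symmetric[OF transpose_signless_laplacian[of E]] by blast+

section \<open>Fractional matchings\<close>

lemma sum_vertex_loads:
  fixes f :: "'a::finite set \<Rightarrow> real"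
  shows "(\<Sum>v\<in>X. \<Sum>e\<in>incident_edges E v. f e) = (\<Sum>e\<in>E. real (card (e \<inter> X)) * f e)"
proof -
  have "(\<Sum>v\<in>X. \<Sum>e\<in>incident_edges E v. f e) = (\<Sum>v\<in>X. \<Sum>e\<in>E. if v \<in> e then f e else 0)"
    by (simp add: incident_edges_def sum.inter_filter)
  also have "\<dots> = (\<Sum>e\<in>E. \<Sum>v\<in>X. if v \<in> e then f e else 0)"
    by (rule sum.swap)
  also have "\<dots> = (\<Sum>e\<in>E. real (card (e \<inter> X)) * f e)"
    by (intro sum.cong refl) (simp add: Int_def conj_commute flip: sum.inter_filter)
  finally show ?thesis .
qed

text \<open>Weak linear programming duality: weight 1 on \<open>S\<close>, 1/2 outside
  \<open>S \<union> T\<close> and 0 on \<open>T\<close> is a fractional vertex cover, and the bound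
  is twice its total weight.\<close>

lemma fractional_matching_le:
  fixes E :: "'a::finite set set"
  assumes E: "simple_graph E" and f: "fractional_matching E f" and disj: "S \<inter> T = {}"
    and nbr: "\<And>u v. u \<in> T \<Longrightarrow> {u, v} \<in> E \<Longrightarrow> v \<in> S"
  shows "2 * (\<Sum>e\<in>E. f e) \<le> real CARD('a) + real (card S) - real (card T)"
proof -
  let ?L = "\<lambda>v. \<Sum>e\<in>incident_edges E v. f e"
  let ?R = "- (S \<union> T)"
  have load: "?L v \<le> 1" for v using f by (simp add: fractional_matching_def)
  have "2 * f e \<le> (2 * real (card (e \<inter> S)) + real (card (e \<inter> ?R))) * f e" if "e \<in> E" for e
  proof -
    have e2: "card e = 2" using E that by (simp add: simple_graph_def)
    then obtain x y where xy: "e = {x, y}" "x \<noteq> y" by (auto simp: card_2_iff)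
    \<comment> \<open>No edge lies inside \<open>T\<close>, and an edge touching \<open>T\<close>
      has its other end in \<open>S\<close>; this gives the covering condition at
      \<open>e\<close>.\<close>
    have "card (e \<inter> T) \<le> card (e \<inter> S)"
      using that nbr[of x y] nbr[of y x] disj xy by (auto simp: insert_commute Int_insert_left)
    moreover have "card (e \<inter> S \<union> e \<inter> T) = card (e \<inter> S) + card (e \<inter> T)"
      using disj by (intro card_Un_disjoint) auto
    moreover have "card ((e \<inter> S \<union> e \<inter> T) \<union> e \<inter> ?R) = card (e \<inter> S \<union> e \<inter> T) + card (e \<inter> ?R)"
      by (intro card_Un_disjoint) auto
    moreover have "(e \<inter> S \<union> e \<inter> T) \<union> e \<inter> ?R = e"
      by auto
    ultimately have "2 \<le> 2 * card (e \<inter> S) + card (e \<inter> ?R)"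
      using e2 by simp
    then have "2 \<le> 2 * real (card (e \<inter> S)) + real (card (e \<inter> ?R))"
      by linarith
    then show ?thesis
      using f that by (intro mult_right_mono) (auto simp: fractional_matching_def)
  qed
  then have "2 * (\<Sum>e\<in>E. f e) \<le> (\<Sum>e\<in>E. (2 * real (card (e \<inter> S)) + real (card (e \<inter> ?R))) * f e)"
    unfolding sum_distrib_left by (intro sum_mono)
  also have "\<dots> = 2 * (\<Sum>v\<in>S. ?L v) + (\<Sum>v\<in>?R. ?L v)"
    unfolding sum_vertex_loads by (simp add: distrib_right sum.distrib sum_distrib_left mult.assoc)
  also have "\<dots> \<le> 2 * real (card S) + real (card ?R)"
    using sum_bounded_above[of S ?L 1] sum_bounded_above[of ?R ?L 1] load by simp
  also have "real (card ?R) = real CARD('a) - real (card S) - real (card T)"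
    using disj card_mono[of UNIV "S \<union> T"]
    by (simp add: Compl_eq_Diff_UNIV card_Diff_subset card_Un_disjoint of_nat_diff)
  finally show ?thesis by simp
qed

lemma fractional_matching_number_eqI:
  assumes "fractional_matching E f" and "(\<Sum>e\<in>E. f e) = m"
    and "\<And>g. fractional_matching E g \<Longrightarrow> (\<Sum>e\<in>E. g e) \<le> m"
  shows "fractional_matching_number E = m"
  unfolding fractional_matching_number_def
  using assms by (intro Greatest_equality) auto

text \<open>Each \<open>v\<close> in \<open>M\<close> puts weight 1/2 on its edge to
  \<open>R v\<close>. A vertex is charged at most once as a source and, by injectivity, at most once
  as a target.\<close>

lemma fractional_matching_of_partial_injection:
  fixes E :: "'a::finite set set"
  assumes E: "simple_graph E" and inj: "inj_on R M" and edge: "\<And>v. v \<in> M \<Longrightarrow> {v, R v} \<in> E"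
  defines "f \<equiv> \<lambda>e. real (card {v \<in> M. {v, R v} = e}) / 2"
  shows "fractional_matching E f" and "(\<Sum>e\<in>E. f e) = real (card M) / 2"
proof -
  \<comment> \<open>Used for \<open>E\<close> to get the total weight and for
    \<open>incident_edges E u\<close> to get the load at \<open>u\<close>.\<close>
  have sum: "(\<Sum>e\<in>F. f e) = real (card {v \<in> M. {v, R v} \<in> F}) / 2" for F
  proof -
    have "{v \<in> M. {v, R v} \<in> F} = (\<Union>e\<in>F. {v \<in> M. {v, R v} = e})" by auto
    then have "card {v \<in> M. {v, R v} \<in> F} = (\<Sum>e\<in>F. card {v \<in> M. {v, R v} = e})"
      by (simp, subst card_UN_disjoint) auto
    then show ?thesis by (simp add: f_def sum_divide_distrib)
  qed
  have "{v \<in> M. {v, R v} \<in> E} = M" using edge by auto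
  then show "(\<Sum>e\<in>E. f e) = real (card M) / 2" by (simp add: sum)
  have "f e \<le> 1" if "e \<in> E" for e
  proof -
    have "card {v \<in> M. {v, R v} = e} \<le> card e" by (rule card_mono) auto
    then show ?thesis using E that by (simp add: f_def simple_graph_def)
  qed
  moreover have "(\<Sum>e\<in>incident_edges E u. f e) \<le> 1" for u
  proof -
    have "card {v \<in> M. {v, R v} \<in> incident_edges E u} \<le> card ({u} \<union> {v \<in> M. R v = u})"
      by (rule card_mono) (auto simp: incident_edges_def)
    also have "\<dots> \<le> card {u} + card {v \<in> M. R v = u}" by (rule card_Un_le)
    also have "card {v \<in> M. R v = u} \<le> card {u}"
      using inj by (intro card_inj_on_le[of R]) (auto simp: inj_on_def)
    finally show ?thesis by (simp add: sum)
  qed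
  ultimately show "fractional_matching E f"
    by (auto simp: fractional_matching_def f_def)
qed

text \<open>\<open>X\<close> below is a set of maximum deficiency in the bipartite double cover of the graph; removing
  from \<open>X\<close> and from its neighbourhood their common part leaves \<open>T\<close> and \<open>S\<close>.\<close>

lemma fractional_berge_formula:
  fixes E :: "'a::finite set set"
  assumes E: "simple_graph E"
  obtains S T f where "S \<inter> T = {}" and "card S \<le> card T"
    and "\<And>u v. u \<in> T \<Longrightarrow> {u, v} \<in> E \<Longrightarrow> v \<in> S"
    and "fractional_matching E f" and "(\<Sum>e\<in>E. f e) = fractional_matching_number E"
    and "2 * fractional_matching_number E = real CARD('a) + real (card S) - real (card T)"
proof -
  define N where "N = (\<lambda>X. \<Union>i\<in>X. {j. {i, j} \<in> E})"
  define D where "D = (\<lambda>X. int (card X) - int (card (N X)))"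
  have "Max (range D) \<in> range D" by (rule Max_in) auto
  then obtain X where X: "D X = Max (range D)" by (metis imageE)
  have max: "D Y \<le> D X" for Y unfolding X by (rule Max_ge) auto
  \<comment> \<open>The empty set has deficiency 0. Hence \<open>nat (D X)\<close> loses nothing,
    and later \<open>card S \<le> card T\<close> follows.\<close>
  have "0 \<le> D X" using max[of "{}"] by (simp add: D_def N_def)
  then have d: "int (nat (D X)) = D X" by simp
  \<comment> \<open>A partial injection along edges is a matching of the bipartite double
    cover.\<close>
  have "\<exists>M R. M \<subseteq> UNIV \<and> card (UNIV :: 'a set) \<le> card M + nat (D X) \<and> inj_on R M
      \<and> (\<forall>i\<in>M. R i \<in> {j. {i, j} \<in> E})"
  proof (rule hall_deficiency)
    show "card J \<le> card (\<Union>i\<in>J. {j. {i, j} \<in> E}) + nat (D X)" for J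
      using max[of J] d by (simp add: D_def N_def)
  qed auto
  then obtain M R where M: "CARD('a) \<le> card M + nat (D X)" "inj_on R M"
    "\<And>i. i \<in> M \<Longrightarrow> {i, R i} \<in> E"
    by blast
  define S T where "S = N X - X" and "T = X - N X"
  have disj: "S \<inter> T = {}" by (auto simp: S_def T_def)
  \<comment> \<open>\<open>v\<close> lies in \<open>N X\<close>; if it also lay in \<open>X\<close>,
    then \<open>u\<close> would be in \<open>N X\<close>, contrary to the choice of
    \<open>T\<close>.\<close>
  have nbr: "v \<in> S" if "u \<in> T" "{u, v} \<in> E" for u v
    using that by (auto simp: S_def T_def N_def insert_commute)
  have ST: "D X = int (card T) - int (card S)"
    using card_Diff_subset_Int[of X "N X"] card_Diff_subset_Int[of "N X" X]
      card_mono[of X "X \<inter> N X"] card_mono[of "N X" "N X \<inter> X"]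
    by (simp add: S_def T_def D_def Int_commute)
  obtain f where f: "fractional_matching E f" "(\<Sum>e\<in>E. f e) = real (card M) / 2"
    using fractional_matching_of_partial_injection[OF E M(2,3)] by blast
  let ?m = "(real CARD('a) + real (card S) - real (card T)) / 2"
  have le: "(\<Sum>e\<in>E. g e) \<le> ?m" if "fractional_matching E g" for g
  proof -
    have "2 * (\<Sum>e\<in>E. g e) \<le> 2 * ?m"
      using fractional_matching_le[OF E that disj] nbr by simp
    then show ?thesis by simp
  qed
  have "CARD('a) + card S \<le> card M + card T"
    using M(1) d ST by linarith
  then have "real CARD('a) + real (card S) \<le> real (card M) + real (card T)"
    by (simp flip: of_nat_add)
  then have "?m \<le> real (card M) / 2"
    by simp
  then have m: "(\<Sum>e\<in>E. f e) = ?m"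
    using f le[OF f(1)] by simp
  then have "fractional_matching_number E = ?m"
    using le by (intro fractional_matching_number_eqI[OF f(1)])
  then show thesis
    using disj nbr ST \<open>0 \<le> D X\<close> f(1) m by (intro that[of S T f]) auto
qed

section \<open>The spectral bound\<close>

lemma min_degree_le_degree: "min_degree E \<le> degree E v"
  by (simp add: min_degree_def)

lemma card_mult_min_degree_le_sum_degree:
  "real (card A) * real (min_degree E) \<le> (\<Sum>v\<in>A. real (degree E v))"
  by (rule sum_bounded_below) (simp add: min_degree_le_degree)

text \<open>The Rayleigh quotient of the all-ones vector is twice the average degree.\<close>

lemma twice_min_degree_le_q1:
  fixes E :: "'a::finite set set"
  assumes E: "simple_graph E"
  shows "2 * real (min_degree E) \<le> q1 E"
proof -
  let ?x = "\<chi> i. 1 :: real^'a"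
  let ?d = "\<lambda>i. real (degree E i)"
  have "2 * (?x \<bullet> (signless_laplacian E *v ?x)) = 4 * (\<Sum>i\<in>UNIV. ?d i)"
    by (simp add: signless_laplacian_quadratic_form[OF E] degree_eq_sum_adjacency[OF E]
        sum_distrib_left mult.commute)
  moreover have "?x \<bullet> (signless_laplacian E *v ?x) \<le> q1 E * real CARD('a)"
    using rayleigh_le_q1[of ?x E] by (simp add: inner_vec_def)
  moreover have "real CARD('a) * real (min_degree E) \<le> (\<Sum>i\<in>UNIV. ?d i)"
    by (rule card_mult_min_degree_le_sum_degree)
  ultimately have "2 * (real CARD('a) * real (min_degree E)) \<le> q1 E * real CARD('a)"
    by linarith
  then have "real CARD('a) * (2 * real (min_degree E)) \<le> real CARD('a) * q1 E"
    by (simp only: mult_ac)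
  then show ?thesis by simp
qed

text \<open>The test vector below is the Perron eigenvector of a biregular bipartite graph with parts
  \<open>T\<close> and \<open>S\<close>.\<close>

lemma
  fixes E :: "'a::finite set set"
  assumes E: "simple_graph E" and disj: "S \<inter> T = {}"
    and nbr: "\<And>u v. u \<in> T \<Longrightarrow> {u, v} \<in> E \<Longrightarrow> v \<in> S"
    and "T \<noteq> {}"
  shows min_degree_mult_le_q1_mult:
      "real (min_degree E) * (real (card S) + real (card T)) \<le> q1 E * real (card S)" (is ?le)
    and biregular_if_min_degree_mult_eq_q1_mult:
      "real (min_degree E) * (real (card S) + real (card T)) = q1 E * real (card S) \<Longrightarrow> S \<union> T = UNIV \<Longrightarrow>
       bipartition E T S \<and> (\<forall>v\<in>T. degree E v = min_degree E) \<and> (\<forall>u\<in>S. \<forall>v\<in>S. degree E u = degree E v)"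
proof -
  define s t where "s = real (card S)" and "t = real (card T)"
  let ?\<delta> = "real (min_degree E)"
  let ?a = "\<lambda>i j. adjacency_matrix E $ i $ j"
  let ?d = "\<lambda>i. real (degree E i)"
  let ?Q = "signless_laplacian E"
  have t: "t > 0" using \<open>T \<noteq> {}\<close> by (simp add: t_def card_gt_0_iff)
  have s: "s \<ge> 0" by (simp add: s_def)
  define x :: "real^'a" where "x = (\<chi> i. if i \<in> T then s else if i \<in> S then t else 0)"
  have xT: "x $ i = s" if "i \<in> T" for i using that by (simp add: x_def)
  have xS: "x $ i = t" if "i \<in> S" for i using that disj by (auto simp: x_def)
  have xx: "x \<bullet> x = s * t * (s + t)"
  proof -
    have "x \<bullet> x = (\<Sum>i\<in>UNIV. (if i \<in> T then s\<^sup>2 else 0) + (if i \<in> S then t\<^sup>2 else 0))"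
      unfolding inner_vec_def using disj by (intro sum.cong) (auto simp: x_def power2_eq_square)
    also have "\<dots> = t * s\<^sup>2 + s * t\<^sup>2"
      by (simp add: sum.distrib s_def t_def flip: sum.inter_filter)
    finally show ?thesis by (simp add: power2_eq_square algebra_simps)
  qed
  \<comment> \<open>The surplus of an ordered pair in the quadratic form after removing
    \<open>(s + t)\<^sup>2\<close> for edges touching \<open>T\<close>: it is 0 on those edges and a
    square on all others.\<close>
  define g where "g = (\<lambda>i j. ?a i j * (x $ i + x $ j)\<^sup>2
    - ((if i \<in> T then ?a i j * (s + t)\<^sup>2 else 0) + (if j \<in> T then ?a i j * (s + t)\<^sup>2 else 0)))"
  have g0: "0 \<le> g i j" for i j
  proof (cases "{i, j} \<in> E")
    case True
    then have ji: "{j, i} \<in> E" by (simp add: insert_commute)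
    show ?thesis
      using True nbr[of i j] nbr[of j i] ji disj xT xS by (auto simp: g_def add.commute adjacency_matrix_def)
  qed (simp add: g_def adjacency_matrix_def)
  have row: "(\<Sum>i\<in>UNIV. \<Sum>j\<in>UNIV. if i \<in> T then ?a i j * (s + t)\<^sup>2 else 0) = (s + t)\<^sup>2 * (\<Sum>i\<in>T. ?d i)"
  proof -
    have "(\<Sum>i\<in>UNIV. \<Sum>j\<in>UNIV. if i \<in> T then ?a i j * (s + t)\<^sup>2 else 0)
        = (\<Sum>i\<in>UNIV. if i \<in> T then ?d i * (s + t)\<^sup>2 else 0)"
      by (intro sum.cong refl) (simp add: degree_eq_sum_adjacency[OF E] sum_distrib_right)
    then show ?thesis by (simp add: sum_distrib_left sum_distrib_right mult.commute flip: sum.inter_filter)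
  qed
  have col: "(\<Sum>i\<in>UNIV. \<Sum>j\<in>UNIV. if j \<in> T then ?a i j * (s + t)\<^sup>2 else 0) = (s + t)\<^sup>2 * (\<Sum>i\<in>T. ?d i)"
    unfolding row[symmetric] by (subst sum.swap) (subst adjacency_matrix_commute, rule refl)
  have gsum: "(\<Sum>i\<in>UNIV. \<Sum>j\<in>UNIV. g i j) = 2 * (x \<bullet> (?Q *v x)) - 2 * ((s + t)\<^sup>2 * (\<Sum>i\<in>T. ?d i))"
    unfolding g_def sum_subtractf sum.distrib row col signless_laplacian_quadratic_form[OF E] by simp
  have gsum0: "(\<Sum>i\<in>UNIV. \<Sum>j\<in>UNIV. g i j) \<ge> 0" by (intro sum_nonneg g0)
  then have xQx: "(s + t)\<^sup>2 * (\<Sum>i\<in>T. ?d i) \<le> x \<bullet> (?Q *v x)" using gsum by linarith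
  have "t * ?\<delta> \<le> (\<Sum>i\<in>T. ?d i)"
    unfolding t_def by (rule card_mult_min_degree_le_sum_degree)
  then have dT: "(s + t)\<^sup>2 * (t * ?\<delta>) \<le> (s + t)\<^sup>2 * (\<Sum>i\<in>T. ?d i)"
    by (intro mult_left_mono) auto
  have ray: "x \<bullet> (?Q *v x) \<le> q1 E * (s * t * (s + t))"
    using rayleigh_le_q1[of x E] by (simp add: xx)
  \<comment> \<open>Chain the degree bound on \<open>T\<close>, the nonnegative surplus and the
    Rayleigh bound; the common factor \<open>t * (s + t)\<close> then cancels.\<close>
  have "(t * (s + t)) * (?\<delta> * (s + t)) \<le> (t * (s + t)) * (q1 E * s)"
    using xQx dT ray by (simp add: power2_eq_square mult_ac)
  moreover have "t * (s + t) > 0" using s t by simp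
  ultimately have "?\<delta> * (s + t) \<le> q1 E * s" by (simp only: mult_le_cancel_left_pos)
  then show ?le by (simp add: s_def t_def)
  assume eq: "?\<delta> * (real (card S) + real (card T)) = q1 E * real (card S)" and UN: "S \<union> T = UNIV"
  then have eq': "q1 E * s = ?\<delta> * (s + t)" by (simp add: s_def t_def)
  have "q1 E * (s * t * (s + t)) = (q1 E * s) * (t * (s + t))" by (simp add: mult_ac)
  also have "\<dots> = (s + t)\<^sup>2 * (t * ?\<delta>)" unfolding eq' by (simp add: power2_eq_square mult_ac)
  finally have top: "q1 E * (s * t * (s + t)) = (s + t)\<^sup>2 * (t * ?\<delta>)" .
  \<comment> \<open>The two ends of the chain now coincide, so every link is an equality:
    \<open>x\<close> is an eigenvector and every surplus \<open>g i j\<close> vanishes.\<close>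
  have "x \<bullet> (?Q *v x) = q1 E * (x \<bullet> x)" unfolding xx using xQx dT ray top by linarith
  then have eig: "?Q *v x = q1 E *s x" by (rule rayleigh_eq_q1_imp_eigenvector)
  have "(\<Sum>i\<in>UNIV. \<Sum>j\<in>UNIV. g i j) = 0"
    using gsum xQx dT ray top gsum0 by linarith
  then have gz: "g i j = 0" for i j
    by (simp add: sum_nonneg_eq_0_iff sum_nonneg g0)
  \<comment> \<open>An edge inside \<open>S\<close> would have the positive surplus
    \<open>(2 * t)\<^sup>2\<close>.\<close>
  have Snbr: "j \<in> T" if "i \<in> S" "{i, j} \<in> E" for i j
  proof (rule ccontr)
    assume "j \<notin> T"
    then have "j \<in> S" using UN by auto
    then have "g i j = (2 * t)\<^sup>2"
      using that disj xS by (auto simp: g_def adjacency_matrix_def)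
    then show False using gz t by simp
  qed
  \<comment> \<open>Every edge joins \<open>T\<close> to \<open>S\<close>, so each neighbour
    contributes \<open>s + t\<close> to the eigenvector equation at \<open>i\<close>.\<close>
  have deg: "?d i * (s + t) = q1 E * x $ i" for i
  proof -
    have "(\<Sum>j\<in>UNIV. ?a i j * (x $ i + x $ j)) = (\<Sum>j\<in>UNIV. ?a i j * (s + t))"
    proof (rule sum.cong)
      fix j
      have "i \<in> T \<or> i \<in> S" using UN by auto
      then
      show "?a i j * (x $ i + x $ j) = ?a i j * (s + t)"
        using nbr[of i j] Snbr[of i j] xS xT by (auto simp: adjacency_matrix_def)
    qed simp
    then show ?thesis
      using arg_cong[OF eig, of "\<lambda>v. v $ i"]
      by (simp add: signless_laplacian_mult[OF E] degree_eq_sum_adjacency[OF E] sum_distrib_right)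
  qed
  have st: "s + t \<noteq> 0" using s t by simp
  have "degree E v = min_degree E" if "v \<in> T" for v
    using deg[of v] eq' st xT[OF that] by simp
  moreover have "degree E u = degree E v" if "u \<in> S" "v \<in> S" for u v
    using deg[of u] deg[of v] st xS that by (metis mult_right_cancel of_nat_eq_iff)
  moreover have "bipartition E T S"
    unfolding bipartition_def
  proof (intro conjI ballI)
    fix e assume e: "e \<in> E"
    then have "card e = 2" using E by (simp add: simple_graph_def)
    then obtain a b where ab: "e = {a, b}" by (auto simp: card_2_iff)
    have "{b, a} = {a, b}" by auto
    then show "\<exists>u\<in>T. \<exists>v\<in>S. e = {u, v}"
      using ab e UN nbr[of a b] nbr[of b a] Snbr[of a b] Snbr[of b a]
      by (metis UNIV_I UnE)
  qed (use UN disj in auto)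
  ultimately show "bipartition E T S \<and> (\<forall>v\<in>T. degree E v = min_degree E)
      \<and> (\<forall>u\<in>S. \<forall>v\<in>S. degree E u = degree E v)"
    by blast
qed

(* The equality clause carries the two properties built into the family: connectedness and
   a positive parameter k. Without them it fails: a regular graph attains equality with k = 0
   (e.g. a triangle), and so does the disjoint union of two copies of a member of the family. *)
theorem theorem3p2:
  fixes E :: "'a::finite set set" and \<delta> :: nat
  assumes "simple_graph E"
    and "min_degree E = \<delta>"
  shows "fractional_matching_number E \<ge> real CARD('a) * real \<delta> / q1 E \<and>
    (connected_graph E \<and> real CARD('a) * (q1 E - 2 * real \<delta>) / q1 E > 0 \<longrightarrow>
      (fractional_matching_number E = real CARD('a) * real \<delta> / q1 E \<longleftrightarrow>
        (\<exists>k::nat. real k = real CARD('a) * (q1 E - 2 * real \<delta>) / q1 E \<and> E \<in> family_H \<delta> k)))"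
proof -
  define n q \<alpha> d where "n = real CARD('a)" and "q = q1 E" and "\<alpha> = fractional_matching_number E"
    and "d = real \<delta>"
  obtain S T f where disj: "S \<inter> T = {}" and ST: "card S \<le> card T"
    and nbr: "\<And>u v. u \<in> T \<Longrightarrow> {u, v} \<in> E \<Longrightarrow> v \<in> S"
    and f: "fractional_matching E f" "(\<Sum>e\<in>E. f e) = fractional_matching_number E"
    and berge: "2 * fractional_matching_number E = real CARD('a) + real (card S) - real (card T)"
    using fractional_berge_formula[OF assms(1)] by metis
  define s t where "s = real (card S)" and "t = real (card T)"
  have st: "0 \<le> s" "s \<le> t" using ST by (simp_all add: s_def t_def)
  have \<alpha>: "2 * \<alpha> = n + s - t" using berge by (simp add: n_def \<alpha>_def s_def t_def)
  have n: "n > 0" by (simp add: n_def)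
  have "card (S \<union> T) \<le> CARD('a)" by (intro card_mono) auto
  then have stn: "s + t \<le> n"
    using disj by (simp add: card_Un_disjoint s_def t_def n_def)
  have d0: "0 \<le> d" by (simp add: d_def)
  have qd: "2 * d \<le> q"
    using twice_min_degree_le_q1[OF assms(1)] assms(2) by (simp add: q_def d_def)
  have dq: "d * (s + t) \<le> q * s"
  proof (cases "T = {}")
    case True
    then show ?thesis using st by (simp add: t_def)
  next
    case False
    show ?thesis
      using min_degree_mult_le_q1_mult[OF assms(1) disj _ False] nbr assms(2)
      by (simp add: q_def d_def s_def t_def)
  qed
  have mono: "(s + t) * (q - 2 * d) \<le> n * (q - 2 * d)"
    using stn qd by (intro mult_right_mono) auto
  have main: "n * d / q \<le> \<alpha>"
  proof (cases "q = 0")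
    \<comment> \<open>Division by zero yields 0, so only \<open>0 \<le> \<alpha>\<close> remains,
      which follows from \<open>s + t \<le> n\<close>.\<close>
    case True
    then show ?thesis using \<alpha> st stn by simp
  next
    case False
    then have "q > 0" using qd d0 by linarith
    have "2 * (n * d) \<le> 2 * (\<alpha> * q)"
      using mono dq arg_cong[OF \<alpha>, of "\<lambda>z. z * q"] by (simp add: algebra_simps)
    then show ?thesis using \<open>q > 0\<close> by (simp add: divide_le_eq)
  qed
  have "\<alpha> = n * d / q \<longleftrightarrow> (\<exists>k::nat. real k = n * (q - 2 * d) / q \<and> E \<in> family_H \<delta> k)"
    if con: "connected_graph E" and pos: "n * (q - 2 * d) / q > 0"
  proof -
    have q: "q > 0" using pos qd d0 by (cases "q = 0") auto
    have kq: "n * (q - 2 * d) / q = n - 2 * (n * d / q)"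
      using q by (simp add: field_simps)
    show ?thesis
    proof
      assume eq: "\<alpha> = n * d / q"
      have k: "n * (q - 2 * d) / q = t - s" using kq \<alpha> eq by linarith
      then have ts: "n * (q - 2 * d) = (t - s) * q" using q by (simp add: field_simps)
      have q2: "q - 2 * d > 0" using pos q n by (simp add: zero_less_divide_iff zero_less_mult_iff)
      \<comment> \<open>The reverse of \<open>mono\<close>; as \<open>q - 2 * d\<close> is positive,
        \<open>S\<close> and \<open>T\<close> must cover all vertices.\<close>
      have "n * (q - 2 * d) \<le> (s + t) * (q - 2 * d)"
        unfolding ts using dq by (simp add: algebra_simps)
      then have nst: "n = s + t" using q2 stn by simp
      then have deq: "d * (s + t) = q * s"
        using ts by (simp add: algebra_simps)
      have "card (S \<union> T) = CARD('a)"
        using nst disj by (simp add: card_Un_disjoint s_def t_def n_def flip: of_nat_add)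
      then have UN: "S \<union> T = UNIV" by (simp add: card_eq_UNIV_imp_eq_UNIV)
      have tpos: "t > s" using k pos by simp
      then have Tne: "T \<noteq> {}" using st by (auto simp: t_def)
      have H: "bipartition E T S \<and> (\<forall>v\<in>T. degree E v = \<delta>)
          \<and> (\<forall>u\<in>S. \<forall>v\<in>S. degree E u = degree E v)"
        unfolding assms(2)[symmetric]
      proof (rule biregular_if_min_degree_mult_eq_q1_mult[OF assms(1) disj _ Tne _ UN])
        show "v \<in> S" if "u \<in> T" "{u, v} \<in> E" for u v using that by (rule nbr)
        show "real (min_degree E) * (real (card S) + real (card T)) = q1 E * real (card S)"
          using deq assms(2) by (simp add: q_def d_def s_def t_def)
      qed
      \<comment> \<open>Otherwise \<open>S\<close> is empty, the bipartition leaves no edges, and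
        the zero matrix would have the positive eigenvalue \<open>q\<close>.\<close>
      have "\<delta> \<noteq> 0"
      proof
        assume "\<delta> = 0"
        then have "S = {}" using deq q by (simp add: d_def s_def)
        then have "E = {}" using H by (auto simp: bipartition_def)
        then have "signless_laplacian E = 0"
          by (simp add: signless_laplacian_def degree_matrix_def adjacency_matrix_def degree_def
              incident_edges_def vec_eq_iff)
        then show False
          using q1_is_eigenvalue[of E] q by (auto simp: eigenvalue_def q_def)
      qed
      moreover have "0 < card T - card S" "card T = card S + (card T - card S)"
        using tpos by (simp_all add: s_def t_def)
      ultimately have "E \<in> family_H \<delta> (card T - card S)"
        unfolding family_H_def mem_Collect_eq using H con assms(1) by blast
      moreover have "real (card T - card S) = n * (q - 2 * d) / q"
        using k ST by (simp add: s_def t_def of_nat_diff)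
      ultimately show "\<exists>k::nat. real k = n * (q - 2 * d) / q \<and> E \<in> family_H \<delta> k" by blast
    next
      assume "\<exists>k::nat. real k = n * (q - 2 * d) / q \<and> E \<in> family_H \<delta> k"
      then obtain k V1 V2 where k: "real k = n * (q - 2 * d) / q"
        and bip: "bipartition E V1 V2" and card: "card V1 = card V2 + k"
        unfolding family_H_def by blast
      \<comment> \<open>Duality with \<open>V2\<close> as \<open>S\<close> and \<open>V1\<close> as
        \<open>T\<close> gives \<open>2 * \<alpha> \<le> n - k\<close>, which matches the lower
        bound \<open>main\<close>.\<close>
      have "2 * \<alpha> \<le> n + real (card V2) - real (card V1)"
        unfolding \<alpha>_def f(2)[symmetric] n_def
      proof (rule fractional_matching_le[OF assms(1) f(1)])
        show "V2 \<inter> V1 = {}" using bip by (auto simp: bipartition_def)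
        show "v \<in> V2" if "u \<in> V1" "{u, v} \<in> E" for u v
          using bip that unfolding bipartition_def by (metis IntI doubleton_eq_iff empty_iff)
      qed
      then have "2 * \<alpha> \<le> n - real k" using card by simp
      then have "\<alpha> \<le> n * d / q" unfolding k kq by simp
      then show "\<alpha> = n * d / q" using main by linarith
    qed
  qed
  then show ?thesis
    using main by (simp add: n_def q_def \<alpha>_def d_def)
qed

end
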